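(* The logarithmic monoid $L=\{\log_2(i): i\in\mathbb{N}\}$ is the unique product-compatible normalized tempered monoid.
   Context: $\mathbb{N}=\{1,2,3,\dots\}$. A tempered monoid is a strictly increasing sequence $M=\{\mu_1,\mu_2,\mu_3,\dots\}$ of non-negative real numbers such that (i) $\mu_1=0$; (ii) $\lim_{n\to\infty}(\mu_{n+1}-\mu_n)=0$; (iii) $M$ is closed under addition, that is, for any $i,j\in\mathbb{N}$ there exists $k\in\mathbb{N}$ such that $\mu_k=\mu_i+\mu_j$. A tempered monoid is normalized if its smallest non-zero element is $1$ (i.e. $\mu_2=1$). A tempered monoid $M=\{\mu_1,\mu_2,\mu_3,\dots\}$ with $\mu_i<\mu_{i+1}$ for all $i$ is product-compatible if $\mu_{ij}=\mu_i+\mu_j$ for any $i,j\in\mathbb{N}$. *)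

theory Defs
  imports Complex_Main
begin

text \<open>
  A strictly increasing sequence and its set of terms determine each other
  (lemma \<open>increasing_enumeration_unique\<close>), so a tempered monoid is represented
  by its set of terms \<open>M\<close>; \<open>increasing_enumeration \<mu> M\<close> recovers the indexing. Sequences are
  indexed from 1: the value \<open>\<mu> 0\<close> is irrelevant and left unconstrained.
\<close>

definition increasing_enumeration :: "(nat \<Rightarrow> real) \<Rightarrow> real set \<Rightarrow> bool" where
  "increasing_enumeration \<mu> M \<longleftrightarrow> strict_mono_on {1..} \<mu> \<and> M = \<mu> ` {1..}"

lemma increasing_enumeration_unique:
  assumes "increasing_enumeration \<mu> M" "increasing_enumeration \<nu> M" "n \<ge> 1"
  shows "\<mu> n = \<nu> n"
proof -
  have le: "g n \<le> f n"
    if f: "increasing_enumeration f M" and g: "increasing_enumeration g M"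
      and n: "n \<ge> 1" and eq: "\<And>k. 1 \<le> k \<Longrightarrow> k < n \<Longrightarrow> f k = g k" for f g n
  proof -
    have "f n \<in> g ` {1..}"
      using f g n unfolding increasing_enumeration_def by auto
    then obtain k where k: "k \<ge> 1" "f n = g k" by auto
    have "\<not> k < n"
    proof
      assume "k < n"
      moreover have "strict_mono_on {1..} f" using f by (simp add: increasing_enumeration_def)
      ultimately have "f k < f n" using strict_mono_onD[of "{1..}" f k n] k(1) n by simp
      then show False using eq[OF k(1)] \<open>k < n\<close> k(2) by simp
    qed
    then consider "n = k" | "n < k" by linarith
    then have "n = k \<or> g n < g k"
    proof cases
      case 2
      have "strict_mono_on {1..} g" using g by (simp add: increasing_enumeration_def)
      then have "g n < g k" using strict_mono_onD[of "{1..}" g n k] 2 n k(1) by simp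
      then show ?thesis ..
    qed simp
    then show ?thesis using k(2) by auto
  qed
  show ?thesis
    using assms(3)
  proof (induction n rule: less_induct)
    case (less n)
    have "\<nu> n \<le> \<mu> n" by (rule le[OF assms(1,2) less.prems]) (rule less.IH)
    moreover have "\<mu> n \<le> \<nu> n" by (rule le[OF assms(2,1) less.prems]) (rule less.IH[symmetric])
    ultimately show ?case by simp
  qed
qed

definition tempered_monoid :: "real set \<Rightarrow> bool" where
  "tempered_monoid M \<longleftrightarrow>
    (\<exists>\<mu>. increasing_enumeration \<mu> M \<and>
         (\<forall>n\<ge>1. \<mu> n \<ge> 0) \<and>
         \<mu> 1 = 0 \<and>
         (\<lambda>n. \<mu> (n + 1) - \<mu> n) \<longlonglongrightarrow> 0 \<and>
         (\<forall>i\<ge>1. \<forall>j\<ge>1. \<exists>k\<ge>1. \<mu> k = \<mu> i + \<mu> j))"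

definition normalized :: "real set \<Rightarrow> bool" where
  "normalized M \<longleftrightarrow> 1 \<in> M \<and> (\<forall>x\<in>M. x \<noteq> 0 \<longrightarrow> 1 \<le> x)"

definition product_compatible :: "real set \<Rightarrow> bool" where
  "product_compatible M \<longleftrightarrow>
    (\<exists>\<mu>. increasing_enumeration \<mu> M \<and> (\<forall>i\<ge>1. \<forall>j\<ge>1. \<mu> (i * j) = \<mu> i + \<mu> j))"

definition log_monoid :: "real set" where
  "log_monoid = {log 2 (real i) | i::nat. i \<ge> 1}"

end

theory Submission
  imports Defs "HOL-Real_Asymp.Real_Asymp"
begin

text \<open>
  The enumeration of a product-compatible monoid turns products of indices into sums, and it is
  increasing. An increasing function \<open>f\<close> with \<open>f (i * j) = f i + f j\<close> is determined by
  its value at 2: trapping \<open>n ^ k\<close> between two consecutive powers of 2 determines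
  \<open>k * f n\<close> up to an error of \<open>f 2\<close>, whatever \<open>k\<close> is, so \<open>f n\<close> is determined
  exactly (lemma \<open>mono_completely_additive_eq_log\<close>). Since \<open>log 2\<close> is such a function,
  \<open>f\<close> is the multiple \<open>f 2 * log 2\<close> of it. Normalization says that the second smallest
  element \<open>\<mu> 2\<close> is 1, hence \<open>\<mu> = log 2\<close>.

  Conversely, the logarithm law makes the logarithmic monoid both product-compatible and closed
  under addition, and its gaps \<open>log 2 (1 + 1 / n)\<close> tend to 0.
\<close>

lemma completely_additive_power:
  fixes f :: "nat \<Rightarrow> real"
  assumes add: "\<And>i j. i \<ge> 1 \<Longrightarrow> j \<ge> 1 \<Longrightarrow> f (i * j) = f i + f j"
    and "n \<ge> 1"
  shows "f (n ^ k) = real k * f n"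
proof (induction k)
  case 0
  show ?case using add[of 1 1] by simp
next
  case (Suc k)
  have "f (n * n ^ k) = f n + f (n ^ k)" using \<open>n \<ge> 1\<close> by (intro add) auto
  then show ?case using Suc by (simp add: algebra_simps)
qed

text \<open>
  If \<open>2 ^ m \<le> n ^ k < 2 ^ (m + 1)\<close>, monotonicity puts \<open>k * f n\<close> between
  \<open>m * f 2\<close> and \<open>(m + 1) * f 2\<close>, and the same interval contains
  \<open>k * (f 2 * log 2 n)\<close>. The two values therefore stay within \<open>f 2\<close> of each other for
  every \<open>k\<close>, which by the Archimedean property forces \<open>f n = f 2 * log 2 n\<close>.
\<close>

lemma mono_completely_additive_eq_log:
  fixes f :: "nat \<Rightarrow> real"
  assumes mono: "mono_on {1..} f"
    and add: "\<And>i j. i \<ge> 1 \<Longrightarrow> j \<ge> 1 \<Longrightarrow> f (i * j) = f i + f j"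
    and n: "n \<ge> 1"
  shows "f n = f 2 * log 2 (real n)"
proof -
  have pow: "f (i ^ k) = real k * f i" if "i \<ge> 1" for i k
    using completely_additive_power[of f, OF add that] .
  have "f 1 \<le> f 2" by (rule mono_onD[OF mono]) auto
  then have f2: "f 2 \<ge> 0" using pow[of 1 0] by simp
  have close: "real k * \<bar>f n - f 2 * log 2 (real n)\<bar> \<le> f 2" for k
  proof -
    obtain m where m: "2 ^ m \<le> n ^ k" "n ^ k < 2 ^ (m + 1)"
      using ex_power_ivl1[of 2 "n ^ k"] n by auto
    have "f (2 ^ m) \<le> f (n ^ k)" "f (n ^ k) \<le> f (2 ^ (m + 1))"
      using m n by (auto intro!: mono_onD[OF mono])
    then have f_bounds: "real m * f 2 \<le> real k * f n" "real k * f n \<le> (real m + 1) * f 2"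
      using n pow[of 2 m] pow[of 2 "m + 1"] pow[of n k] by (simp_all add: algebra_simps)
    have "(2::real) ^ m \<le> real n ^ k" "real n ^ k \<le> 2 ^ (m + 1)"
      using m by (metis of_nat_le_iff of_nat_numeral of_nat_power less_imp_le)+
    then have "log 2 (2 ^ m) \<le> log 2 (real n ^ k)" "log 2 (real n ^ k) \<le> log 2 (2 ^ (m + 1))"
      using n by (subst log_le_cancel_iff; simp)+
    then have "real m \<le> real k * log 2 (real n)" "real k * log 2 (real n) \<le> real m + 1"
      using n by (simp_all add: log_nat_power del: power_Suc)
    then have "real m * f 2 \<le> (real k * log 2 (real n)) * f 2"
      "(real k * log 2 (real n)) * f 2 \<le> (real m + 1) * f 2"
      using f2 by (simp_all only: mult_right_mono)
    with f_bounds have "\<bar>real k * f n - real k * (f 2 * log 2 (real n))\<bar> \<le> f 2"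
      by (simp add: abs_le_iff algebra_simps)
    then show ?thesis
      by (simp add: abs_mult flip: right_diff_distrib)
  qed
  show ?thesis
  proof (rule ccontr)
    assume "f n \<noteq> f 2 * log 2 (real n)"
    then have "\<bar>f n - f 2 * log 2 (real n)\<bar> > 0" by simp
    from reals_Archimedean3[OF this] obtain k
      where "f 2 < real k * \<bar>f n - f 2 * log 2 (real n)\<bar>" by blast
    with close[of k] show False by simp
  qed
qed

lemma normalized_second_element:
  assumes enum: "increasing_enumeration \<mu> M" and "normalized M" and "\<mu> 1 = 0"
  shows "\<mu> 2 = 1"
proof -
  from enum have mono: "strict_mono_on {1..} \<mu>" and M: "M = \<mu> ` {1..}"
    by (simp_all add: increasing_enumeration_def)
  from \<open>normalized M\<close> M obtain k where k: "k \<ge> 1" "\<mu> k = 1"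
    by (auto simp: normalized_def)
  with \<open>\<mu> 1 = 0\<close> have "k \<noteq> 1" by auto
  with k have "\<mu> 2 \<le> \<mu> k"
    by (intro mono_onD[OF strict_mono_on_imp_mono_on[OF mono]]) auto
  moreover have "\<mu> 1 < \<mu> 2" by (rule strict_mono_onD[OF mono]) auto
  moreover have "\<mu> 2 \<in> M" by (simp add: M)
  ultimately show ?thesis
    using \<open>normalized M\<close> k \<open>\<mu> 1 = 0\<close> by (force simp: normalized_def)
qed

lemma increasing_enumeration_log_monoid:
  "increasing_enumeration (\<lambda>n. log 2 (real n)) log_monoid"
  by (auto simp: increasing_enumeration_def log_monoid_def strict_mono_on_def)

lemma log_mult_nat:
  assumes "i \<ge> 1" "j \<ge> 1"
  shows "log 2 (real (i * j)) = log 2 (real i) + log 2 (real j)"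
  using assms by (simp add: log_mult)

lemma tempered_monoid_log_monoid: "tempered_monoid log_monoid"
  unfolding tempered_monoid_def
proof (intro exI[of _ "\<lambda>n. log 2 (real n)"] conjI allI impI)
  show "increasing_enumeration (\<lambda>n. log 2 (real n)) log_monoid"
    by (rule increasing_enumeration_log_monoid)
  show "(\<lambda>n. log 2 (real (n + 1)) - log 2 (real n)) \<longlonglongrightarrow> 0"
    by real_asymp
  fix i j :: nat
  assume "i \<ge> 1" "j \<ge> 1"
  then show "\<exists>k\<ge>1. log 2 (real k) = log 2 (real i) + log 2 (real j)"
    by (intro exI[of _ "i * j"]) (simp add: log_mult)
qed auto

lemma normalized_log_monoid: "normalized log_monoid"
  unfolding normalized_def
proof (intro conjI ballI impI)
  show "1 \<in> log_monoid"
    by (auto simp: log_monoid_def intro!: exI[of _ 2])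
  fix x assume "x \<in> log_monoid" "x \<noteq> 0"
  then obtain i :: nat where i: "i \<ge> 1" "x = log 2 (real i)"
    by (auto simp: log_monoid_def)
  with \<open>x \<noteq> 0\<close> have "i \<noteq> 1" by auto
  with i show "1 \<le> x" by (simp add: le_log_iff)
qed

lemma product_compatible_log_monoid: "product_compatible log_monoid"
  unfolding product_compatible_def
  using increasing_enumeration_log_monoid log_mult_nat by blast

lemma product_compatible_normalized_eq_log_monoid:
  assumes "product_compatible M" "normalized M"
  shows "M = log_monoid"
proof -
  from assms obtain \<mu> where enum: "increasing_enumeration \<mu> M"
    and add: "\<And>i j. i \<ge> 1 \<Longrightarrow> j \<ge> 1 \<Longrightarrow> \<mu> (i * j) = \<mu> i + \<mu> j"
    unfolding product_compatible_def by blast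
  have "\<mu> 1 = 0" using add[of 1 1] by simp
  with enum assms have "\<mu> 2 = 1" by (intro normalized_second_element)
  moreover have "mono_on {1..} \<mu>"
    using enum by (simp add: increasing_enumeration_def strict_mono_on_imp_mono_on)
  ultimately have "\<mu> n = log 2 (real n)" if "n \<ge> 1" for n
    using mono_completely_additive_eq_log[of \<mu>, OF _ add that] by simp
  then show ?thesis
    using enum by (auto simp: increasing_enumeration_def log_monoid_def)
qed

theorem theorem4p3:
  "tempered_monoid log_monoid \<and> normalized log_monoid \<and> product_compatible log_monoid \<and>
   (\<forall>M. tempered_monoid M \<and> normalized M \<and> product_compatible M \<longrightarrow> M = log_monoid)"
  using tempered_monoid_log_monoid normalized_log_monoid product_compatible_log_monoid
    product_compatible_normalized_eq_log_monoid by blast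

end
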